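(* Let $\{A_1,\dots,A_N\}$, $N<\infty$, be a collection of $n\times n$ matrices with nonnegative real entries, each having spectral radius $1$. Assume that: (1) if $N=2$, the pair $(A_1,A_2)$ is partially commuting, or quasi-commuting, or a Laffey pair; (2) if $N\ge 3$, the collection is quasi-commuting. Let $E'=\{v_1,\dots,v_d\}$ denote the set of common eigenvectors of the collection, and let $\mathcal{LC}(E')$ be the associated set of linear combinations (both described in the context). For any positive integer $p$, let $\omega\in\Sigma_N^p$ and let $A_\omega$ be the matrix associated with the word $\omega$. Consider the function $f_\omega:(\mathbb{R}^n_+)^\circ\to(\mathbb{R}^n_+)^\circ$ given by $f_\omega=\exp\circ A_\omega\circ\log$. Then, for any $y=\exp(x)\in(\mathbb{R}^n_+)^\circ$ where $x\in\mathcal{LC}(E')$, there exists an integer $q\ge 1$ such that $$\lim_{k\to\infty}f_\omega^{kq}(y)=\eta_y,$$ where $\eta_y$ is a periodic point of $f_\omega$ whose period divides $q$.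
   Context: Words and products: $\Sigma_N^p$ is the set of all words $\omega=(\omega_1\omega_2\cdots\omega_p)$ with $\omega_j\in\{1,\dots,N\}$. For $\omega\in\Sigma_N^p$, $A_\omega:=A_{\omega_p}A_{\omega_{p-1}}\cdots A_{\omega_2}A_{\omega_1}$. Exponential and logarithm: $(\mathbb{R}^n_+)^\circ$ is the interior of the nonnegative orthant (vectors with all entries positive). $\log:(\mathbb{R}^n_+)^\circ\to\mathbb{R}^n$ and $\exp:\mathbb{R}^n\to(\mathbb{R}^n_+)^\circ$ are defined componentwise: $\log(x)=(\log x_1,\dots,\log x_n)$, $\exp(x)=(e^{x_1},\dots,e^{x_n})$. Commutation notions: $[A,B]:=AB-BA$. A collection $\{A_1,\dots,A_N\}$ is quasi-commuting if for each pair $(r,s)$ of indices both $A_r$ and $A_s$ commute with $[A_r,A_s]$. A pair $(A,B)$ is partially commuting if $A$ and $B$ have common eigenvectors (possibly in $\mathbb{C}^n$). A pair $(A,B)$ is a Laffey pair if $\mathrm{rank}([A,B])=1$. Common eigenvectors: a common eigenvector of the collection is a nonzero vector in $\mathbb{R}^n$ or $\mathbb{C}^n$ that is an eigenvector of every $A_r$ (with eigenvalue possibly depending on $r$). The set of common eigenvectors is listed as $E'=\{v_1,\dots,v_d\}$, $d\le n$, meaning a maximal linearly independent (over $\mathbb{C}$) list of common eigenvectors, chosen so that the non-real ones occur in complex conjugate pairs. Define $$\mathcal{LC}(E')=\{\alpha_1v_1+\cdots+\alpha_dv_d:\ \alpha_j\in\mathbb{C},\ \alpha_{s_1}=\overline{\alpha_{s_2}}\text{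 whenever }v_{s_1}=\overline{v_{s_2}}\text{ is a pair of conjugate non-real vectors, and }\alpha_j\in\mathbb{R}\text{ otherwise}\}\subset\mathbb{R}^n.$$ Periodic points: $y$ is a periodic point of a self-map $f$ if $f^q(y)=y$ for some positive integer $q$; the smallest such $q$ is the period of $y$. $f^{k}$ denotes the $k$-fold composition. *)

theory Defs
  imports "HOL-Analysis.Analysis" "HOL-Combinatorics.Cycles"
begin

section \<open>Complexification and eigenvectors\<close>

definition cvec :: "real^'n \<Rightarrow> complex^'n" where
  "cvec x = (\<chi> i. complex_of_real (x $ i))"

definition cmat :: "real^'n^'m \<Rightarrow> complex^'n^'m" where
  "cmat A = map_matrix complex_of_real A"

definition vcnj :: "complex^'n \<Rightarrow> complex^'n" where
  "vcnj v = (\<chi> i. cnj (v $ i))"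

definition eigenpair :: "complex^'n^'n \<Rightarrow> complex \<Rightarrow> complex^'n \<Rightarrow> bool" where
  "eigenpair M c v \<longleftrightarrow> v \<noteq> 0 \<and> M *v v = c *s v"

definition eigvec :: "complex^'n^'n \<Rightarrow> complex^'n \<Rightarrow> bool" where
  "eigvec M v \<longleftrightarrow> (\<exists>c. eigenpair M c v)"

definition spectrum :: "complex^'n^'n \<Rightarrow> complex set" where
  "spectrum M = {c. \<exists>v. eigenpair M c v}"

definition spec_radius :: "real^'n^'n \<Rightarrow> real" where
  "spec_radius A = (SUP c \<in> spectrum (cmat A). cmod c)"

definition nonneg_mat :: "real^'n^'m \<Rightarrow> bool" where
  "nonneg_mat A \<longleftrightarrow> (\<forall>i j. 0 \<le> A $ i $ j)"


section \<open>Commutation notions\<close>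

text \<open>A collection of matrices is a family \<open>A\<close> of which only the members \<open>A 1, \<dots>, A N\<close> matter.\<close>

definition commutator :: "real^'n^'n \<Rightarrow> real^'n^'n \<Rightarrow> real^'n^'n" where
  "commutator A B = A ** B - B ** A"

definition quasi_commuting :: "(nat \<Rightarrow> real^'n^'n) \<Rightarrow> nat \<Rightarrow> bool" where
  "quasi_commuting A N \<longleftrightarrow>
     (\<forall>r\<in>{1..N}. \<forall>s\<in>{1..N}.
        A r ** commutator (A r) (A s) = commutator (A r) (A s) ** A r \<and>
        A s ** commutator (A r) (A s) = commutator (A r) (A s) ** A s)"

definition partially_commuting :: "real^'n^'n \<Rightarrow> real^'n^'n \<Rightarrow> bool" where
  "partially_commuting A B \<longleftrightarrow> (\<exists>v. eigvec (cmat A) v \<and> eigvec (cmat B) v)"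

definition laffey_pair :: "real^'n^'n \<Rightarrow> real^'n^'n \<Rightarrow> bool" where
  "laffey_pair A B \<longleftrightarrow> rank (commutator A B) = 1"


section \<open>Common eigenvectors and their real linear combinations\<close>

definition common_eigvecs :: "(nat \<Rightarrow> real^'n^'n) \<Rightarrow> nat \<Rightarrow> (complex^'n) set" where
  "common_eigvecs A N = {v. v \<noteq> 0 \<and> (\<forall>r\<in>{1..N}. eigvec (cmat (A r)) v)}"

text \<open>
  The choices of \<open>E'\<close>: maximal sets of common eigenvectors that are linearly independent over the
  complex numbers and in which the non-real vectors come in complex conjugate pairs.  (For a real
  \<open>v\<close> the closure condition is void, as then \<open>vcnj v = v\<close>.)
\<close>

definition common_eigvec_list :: "(nat \<Rightarrow> real^'n^'n) \<Rightarrow> nat \<Rightarrow> (complex^'n) set \<Rightarrow> bool" where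
  "common_eigvec_list A N E \<longleftrightarrow>
     E \<subseteq> common_eigvecs A N \<and> vec.independent E \<and>
     (\<forall>F. E \<subseteq> F \<and> F \<subseteq> common_eigvecs A N \<and> vec.independent F \<longrightarrow> F = E) \<and>
     (\<forall>v\<in>E. vcnj v \<in> E)"

definition LC :: "(complex^'n) set \<Rightarrow> (real^'n) set" where
  "LC E = {x. \<exists>\<alpha>. (\<forall>v\<in>E. if vcnj v = v then \<alpha> v \<in> \<real> else \<alpha> (vcnj v) = cnj (\<alpha> v)) \<and>
                  cvec x = (\<Sum>v\<in>E. \<alpha> v *s v)}"

text \<open>
  The requirement in \<^const>\<open>LC\<close> that the combination be a real vector excludes no coefficients:
\<close>

lemma LC_combination_real:
  fixes E :: "(complex^'n) set"
  assumes conj: "\<And>v. v \<in> E \<Longrightarrow> vcnj v \<in> E"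
    and coeff: "\<forall>v\<in>E. if vcnj v = v then \<alpha> v \<in> \<real> else \<alpha> (vcnj v) = cnj (\<alpha> v)"
  shows "\<exists>x. cvec x = (\<Sum>v\<in>E. \<alpha> v *s v)"
proof -
  let ?s = "\<Sum>v\<in>E. \<alpha> v *s v"
  have inv: "vcnj (vcnj v) = v" for v :: "complex^'n"
    by (simp add: vcnj_def vec_eq_iff)
  have c: "\<alpha> (vcnj v) = cnj (\<alpha> v)" if "v \<in> E" for v
    using coeff that by (cases "vcnj v = v") (auto simp: Reals_cnj_iff)
  have real: "cnj (?s $ i) = ?s $ i" for i
  proof -
    have "cnj (?s $ i) = (\<Sum>v\<in>E. cnj (\<alpha> v) * vcnj v $ i)"
      by (simp add: sum_component vcnj_def)
    also have "\<dots> = (\<Sum>v\<in>E. \<alpha> (vcnj v) * vcnj v $ i)"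
      by (intro sum.cong) (auto simp: c)
    also have "\<dots> = (\<Sum>v\<in>E. \<alpha> v * v $ i)"
      by (rule sum.reindex_bij_witness[of _ vcnj vcnj]) (auto simp: inv conj)
    finally show ?thesis
      by (simp add: sum_component)
  qed
  have "complex_of_real (Re (?s $ i)) = ?s $ i" for i
    using real[of i] by (simp only: Reals_cnj_iff [symmetric] of_real_Re)
  then have "cvec (\<chi> i. Re (?s $ i)) = ?s"
    by (simp only: cvec_def vec_eq_iff vec_lambda_beta simp_thms)
  then show ?thesis ..
qed


section \<open>Words and the map associated with a word\<close>

definition words :: "nat \<Rightarrow> nat \<Rightarrow> nat list set" where
  "words N p = {\<omega>. length \<omega> = p \<and> set \<omega> \<subseteq> {1..N}}"

text \<open>The first letter of the word acts first, i.e. is the rightmost factor.\<close>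

fun word_mat :: "(nat \<Rightarrow> real^'n^'n) \<Rightarrow> nat list \<Rightarrow> real^'n^'n" where
  "word_mat A [] = mat 1"
| "word_mat A (r # \<omega>) = word_mat A \<omega> ** A r"

definition pos_orthant :: "(real^'n) set" where
  "pos_orthant = {x. \<forall>i. 0 < x $ i}"

definition vexp :: "real^'n \<Rightarrow> real^'n" where
  "vexp x = (\<chi> i. exp (x $ i))"

definition vlog :: "real^'n \<Rightarrow> real^'n" where
  "vlog x = (\<chi> i. ln (x $ i))"

text \<open>Only the restriction of this map to \<^const>\<open>pos_orthant\<close> is meaningful.\<close>

definition word_map :: "(nat \<Rightarrow> real^'n^'n) \<Rightarrow> nat list \<Rightarrow> real^'n \<Rightarrow> real^'n" where
  "word_map A \<omega> = vexp \<circ> (*v) (word_mat A \<omega>) \<circ> vlog"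

lemma word_map_in_pos_orthant: "word_map A \<omega> x \<in> pos_orthant"
  by (simp add: word_map_def vexp_def pos_orthant_def)

text \<open>The period of a periodic point \<open>y\<close> of \<open>f\<close> is the library's \<^term>\<open>least_power f y\<close>.\<close>

definition periodic_point :: "('a \<Rightarrow> 'a) \<Rightarrow> 'a \<Rightarrow> bool" where
  "periodic_point f y \<longleftrightarrow> (\<exists>q\<ge>1. (f ^^ q) y = y)"

end

theory Submission
  imports Defs
begin

text \<open>
  The heart of the matter is that an eigenvalue \<open>c\<close> of modulus one of a nonnegative matrix \<open>A\<close> of
  spectral radius one is a root of unity, even when \<open>A\<close> is reducible. If \<open>A v = c v\<close>, the vector
  \<open>u\<close> of absolute values of the entries of \<open>v\<close> satisfies \<open>u \<le> A u\<close>. If from every tight index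
  (where equality holds) the graph of \<open>A\<close>, restricted to the support of \<open>u\<close>, led to a strict one,
  then \<open>u\<close> could be perturbed to a vector \<open>z\<close> with \<open>t z \<le> A z\<close> for some \<open>t > 1\<close>, and Brouwer's
  theorem would give an eigenvalue \<open>\<ge> t\<close>. So some nonempty set of tight indices is never left. Along
  each of its edges the phase of \<open>v\<close> is multiplied by \<open>c\<close>, and following a cycle shows that a power
  of \<open>c\<close> is one.

  Consequently each common eigenvector is scaled by \<open>A\<^sub>\<omega>\<close> with a factor that is either of modulus
  less than one or a root of unity, and \<open>q\<close> is the product of the orders of the latter.
\<close>

section \<open>Complexification and the spectral radius\<close>

lemma cmat_mult_vec: "(cmat A *v v) $ i = (\<Sum>j\<in>UNIV. complex_of_real (A $ i $ j) * v $ j)"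
  by (simp add: cmat_def map_matrix_def matrix_vector_mult_def)

lemma cmat_mult_cvec: "cmat A *v cvec x = cvec (A *v x)"
  by (simp add: vec_eq_iff cmat_mult_vec cvec_def) (simp add: matrix_vector_mult_def)

lemma cmat_mult: "cmat (A ** B) = cmat A ** cmat B"
  by (simp add: cmat_def map_matrix_def matrix_matrix_mult_def vec_eq_iff)

lemma cmat_one: "cmat (mat 1) = mat 1"
  by (simp add: cmat_def map_matrix_def mat_def vec_eq_iff)

lemma norm_vector_scalar_mult: "norm (c *s v) = norm c * norm (v :: 'a::real_normed_field^'n)"
  by (simp add: norm_vec_def norm_mult L2_set_right_distrib)

text \<open>The supremum defining \<open>spec_radius\<close> bounds its members once the moduli are
  known to be bounded above; the operator norm of the matrix provides such a bound.\<close>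

lemma eigenpair_cmod_le_spec_radius:
  assumes "eigenpair (cmat A) c v"
  shows "cmod c \<le> spec_radius A"
  unfolding spec_radius_def
proof (rule cSUP_upper)
  show "c \<in> spectrum (cmat A)"
    using assms by (auto simp: spectrum_def)
  show "bdd_above (cmod ` spectrum (cmat A))"
  proof (rule bdd_aboveI2)
    fix d assume "d \<in> spectrum (cmat A)"
    then obtain u where u: "u \<noteq> 0" "cmat A *v u = d *s u"
      by (auto simp: spectrum_def eigenpair_def)
    have "cmod d * norm u = norm (cmat A *v u)"
      by (simp add: u norm_vector_scalar_mult)
    also have "\<dots> \<le> onorm ((*v) (cmat A)) * norm u"
      by (rule onorm) simp
    finally show "cmod d \<le> onorm ((*v) (cmat A))"
      using u by simp
  qed
qed

section \<open>Collatz-Wielandt bounds for nonnegative matrices\<close>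

lemma nonneg_mat_mult_mono:
  assumes "nonneg_mat A" "\<And>j. x $ j \<le> y $ j"
  shows "(A *v x) $ i \<le> (A *v y) $ i"
  using assms by (auto simp: matrix_vector_mult_def nonneg_mat_def intro!: sum_mono mult_left_mono)

lemma compact_standard_simplex:
  "compact {x :: real^'n. (\<forall>i. 0 \<le> x $ i) \<and> (\<Sum>i\<in>UNIV. x $ i) = 1}" (is "compact ?K")
proof -
  have "x $ i \<le> 1" if "x \<in> ?K" for x i
    using that member_le_sum[of i UNIV "\<lambda>j. x $ j"] by auto
  then have "?K \<subseteq> cbox 0 1"
    by (auto simp: mem_box_cart)
  moreover have "closed ?K"
    by (intro closed_Collect_conj closed_Collect_all closed_Collect_le closed_Collect_eq continuous_intros)
  ultimately show ?thesis
    by (meson bounded_cbox bounded_subset compact_eq_bounded_closed)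
qed

text \<open>
  Brouwer's theorem on the standard simplex \<open>K\<close>. The perturbation \<open>\<delta>\<close> makes the fixed point positive,
  so that it dominates a positive multiple of \<open>w\<close>; a touching index of the largest such multiple
  yields \<open>t \<le> r\<close>.
\<close>
lemma perturbed_positive_eigenvector:
  fixes A :: "real^'n^'n"
  defines "K \<equiv> {x. (\<forall>i. 0 \<le> x $ i) \<and> (\<Sum>i\<in>UNIV. x $ i) = 1}"
  assumes A: "nonneg_mat A" and w: "\<And>i. 0 \<le> w $ i" "w \<noteq> 0"
    and tw: "\<And>i. t * w $ i \<le> (A *v w) $ i" and "0 < \<delta>"
  obtains x r where "x \<in> K" "t \<le> r" "A *v x + \<delta> *\<^sub>R 1 = r *\<^sub>R x"
proof -
  define g where "g x = A *v x + \<delta> *\<^sub>R 1" for x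
  define s where "s x = (\<Sum>i\<in>UNIV. g x $ i)" for x
  have g_pos: "\<delta> \<le> g x $ i" if "x \<in> K" for x i
    using A that by (auto simp: g_def K_def nonneg_mat_def matrix_vector_mult_def intro!: sum_nonneg)
  have s_pos: "0 < s x" if "x \<in> K" for x
    unfolding s_def using g_pos[OF that] \<open>0 < \<delta>\<close> by (intro sum_pos) (auto intro: less_le_trans)
  have cont_g: "continuous_on K g"
    unfolding g_def by (intro continuous_intros linear_continuous_on matrix_vector_mul_bounded_linear)
  have cont: "continuous_on K (\<lambda>x. (1 / s x) *\<^sub>R g x)"
    unfolding s_def
    by (intro continuous_intros cont_g) (use s_pos in \<open>force simp: s_def\<close>)
  have "compact K"
    unfolding K_def by (rule compact_standard_simplex)
  moreover have "convex K"
    by (auto simp: convex_def K_def sum.distrib simp flip: sum_distrib_left)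
  moreover have "axis undefined 1 \<in> K"
    by (simp add: K_def axis_def if_distrib)
  moreover have "(\<lambda>x. (1 / s x) *\<^sub>R g x) \<in> K \<rightarrow> K"
  proof
    fix x assume x: "x \<in> K"
    have "0 \<le> (1 / s x) * g x $ i" for i
      using s_pos[OF x] g_pos[OF x, of i] \<open>0 < \<delta>\<close> by simp
    moreover have "(\<Sum>i\<in>UNIV. (1 / s x) * g x $ i) = 1"
      using s_pos[OF x] unfolding sum_distrib_left[symmetric] s_def[symmetric] by simp
    ultimately show "(1 / s x) *\<^sub>R g x \<in> K"
      by (simp add: K_def)
  qed
  ultimately obtain x where x: "x \<in> K" and fix_x: "(1 / s x) *\<^sub>R g x = x"
    using brouwer[OF _ _ _ cont] by blast
  have "g x = s x *\<^sub>R ((1 / s x) *\<^sub>R g x)"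
    using s_pos[OF x] by simp
  then have eig: "g x = s x *\<^sub>R x"
    by (simp only: fix_x)
  have x_pos: "0 < x $ i" for i
  proof -
    have "0 < s x * x $ i"
      using g_pos[OF x, of i] \<open>0 < \<delta>\<close> unfolding eig by simp
    then show ?thesis
      using s_pos[OF x] zero_less_mult_pos by blast
  qed
  define I where "I = {i. 0 < w $ i}"
  define c where "c = Min ((\<lambda>i. x $ i / w $ i) ` I)"
  have "I \<noteq> {}"
    using w by (force simp: I_def vec_eq_iff order_less_le)
  then have "c \<in> (\<lambda>i. x $ i / w $ i) ` I"
    unfolding c_def by (intro Min_in) auto
  then obtain k where k: "0 < w $ k" "c = x $ k / w $ k"
    by (auto simp: I_def)
  have c_pos: "0 < c"
    using k x_pos by simp
  have "c * w $ i \<le> x $ i" for i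
  proof (cases "0 < w $ i")
    case True
    then have "c \<le> x $ i / w $ i"
      unfolding c_def by (intro Min_le) (auto simp: I_def)
    with True show ?thesis by (simp add: field_simps)
  next
    case False
    then show ?thesis using w(1)[of i] x_pos[of i] by (simp add: order_less_le)
  qed
  then have "(A *v (c *\<^sub>R w)) $ k \<le> (A *v x) $ k"
    using A by (intro nonneg_mat_mult_mono) auto
  moreover have "(A *v (c *\<^sub>R w)) $ k = c * (A *v w) $ k"
    by (simp add: matrix_vector_mult_scaleR)
  \<comment> \<open>At the touching index \<open>c * w $ k = x $ k\<close>, so the hypothesis on
    \<open>w\<close>, scaled by \<open>c\<close>, speaks about \<open>x $ k\<close>.\<close>
  moreover have "t * x $ k \<le> c * (A *v w) $ k"
    using mult_left_mono[OF tw[of k], of c] c_pos k by (simp add: mult_ac)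
  moreover have "(A *v x) $ k + \<delta> = s x * x $ k"
    using arg_cong[OF eig, of "\<lambda>z. z $ k"] by (simp add: g_def)
  ultimately have "t * x $ k \<le> s x * x $ k"
    using \<open>0 < \<delta>\<close> by linarith
  then have "t \<le> s x"
    using x_pos[of k] by simp
  with x eig that show thesis
    by (simp add: g_def)
qed

text \<open>The perturbation tends to zero along \<open>1 / Suc n\<close>, and compactness of the
  simplex yields a limit of the perturbed eigenvectors, nonzero because its coordinates still sum to
  one.\<close>

lemma nonneg_mat_eigenvalue_ge:
  fixes A :: "real^'n^'n"
  assumes A: "nonneg_mat A" and w: "\<And>i. 0 \<le> w $ i" "w \<noteq> 0"
    and tw: "\<And>i. t * w $ i \<le> (A *v w) $ i"
  obtains x r where "t \<le> r" "x \<noteq> 0" "A *v x = r *\<^sub>R x"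
proof -
  define K where "K = {x::real^'n. (\<forall>i. 0 \<le> x $ i) \<and> (\<Sum>i\<in>UNIV. x $ i) = 1}"
  have "\<exists>x r. x \<in> K \<and> t \<le> r \<and> A *v x + (1 / Suc n) *\<^sub>R 1 = r *\<^sub>R x" for n
    by (rule perturbed_positive_eigenvector[OF A w tw, of "1 / Suc n"]) (auto simp: K_def)
  then obtain X R where X: "\<And>n. X n \<in> K" and R: "\<And>n. t \<le> R n"
    and eig: "\<And>n. A *v X n + (1 / Suc n) *\<^sub>R 1 = R n *\<^sub>R X n"
    by metis
  have "compact K"
    unfolding K_def by (rule compact_standard_simplex)
  then obtain x \<phi> where x: "x \<in> K" and \<phi>: "strict_mono \<phi>" "(X \<circ> \<phi>) \<longlonglongrightarrow> x"
    using X unfolding compact_def by metis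
  define s where "s z = (\<Sum>i\<in>UNIV. z $ i)" for z :: "real^'n"
  \<comment> \<open>As the coordinates of \<open>X n\<close> sum to one, the factor
    \<open>R n\<close> is a continuous function of the left-hand side; this makes it converge along
    the subsequence.\<close>
  have R_eq: "R n = s (A *v X n + (1 / Suc n) *\<^sub>R 1)" for n
    using X[of n] unfolding eig by (simp add: s_def K_def flip: sum_distrib_left)
  have "(\<lambda>n. 1 / Suc n) \<longlonglongrightarrow> (0::real)"
    using LIMSEQ_inverse_real_of_nat by (simp add: inverse_eq_divide)
  then have "(\<lambda>n. 1 / Suc (\<phi> n)) \<longlonglongrightarrow> (0::real)"
    using LIMSEQ_subseq_LIMSEQ[OF _ \<phi>(1)] by (force simp: o_def)
  then have lim: "(\<lambda>n. A *v X (\<phi> n) + (1 / Suc (\<phi> n)) *\<^sub>R 1) \<longlonglongrightarrow> A *v x + 0 *\<^sub>R 1"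
    using \<phi>(2) by (intro tendsto_intros bounded_linear.tendsto[OF matrix_vector_mul_bounded_linear])
      (auto simp: o_def)
  then have limR: "(\<lambda>n. R (\<phi> n)) \<longlonglongrightarrow> s (A *v x)"
    unfolding R_eq s_def by (intro tendsto_intros) simp
  have "(\<lambda>n. R (\<phi> n) *\<^sub>R X (\<phi> n)) \<longlonglongrightarrow> s (A *v x) *\<^sub>R x"
    using limR \<phi>(2) by (intro tendsto_intros) (auto simp: o_def)
  with lim have "A *v x = s (A *v x) *\<^sub>R x"
    unfolding eig by (simp add: LIMSEQ_unique)
  moreover have "t \<le> s (A *v x)"
    using LIMSEQ_le_const[OF limR] R by blast
  moreover have "x \<noteq> 0"
    using x by (auto simp: K_def)
  ultimately show thesis
    using that by blast
qed

text \<open>The eigenvalue \<open>r\<close> supplied by the previous lemma is real and at least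
  \<open>t\<close>, hence so is its modulus.\<close>

lemma nonneg_mat_subinvariant_le_spec_radius:
  assumes "nonneg_mat A" "\<And>i. 0 \<le> w $ i" "w \<noteq> 0" "\<And>i. t * w $ i \<le> (A *v w) $ i"
  shows "t \<le> spec_radius A"
proof -
  obtain x r where r: "t \<le> r" "x \<noteq> 0" "A *v x = r *\<^sub>R x"
    using nonneg_mat_eigenvalue_ge[OF assms] by blast
  then have "eigenpair (cmat A) (complex_of_real r) (cvec x)"
    by (auto simp: eigenpair_def cmat_mult_cvec) (auto simp: cvec_def vec_eq_iff)
  then show ?thesis
    using eigenpair_cmod_le_spec_radius[of A r "cvec x"] r(1) by simp
qed

text \<open>
  Raising the entry at a strict index \<open>j\<close> makes every tight index \<open>i\<close> with \<open>0 < A $ i $ j\<close> strict.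
\<close>
lemma strictly_subinvariant_vector:
  fixes A :: "real^'n^'n"
  assumes A: "nonneg_mat A"
    and "\<And>i. i \<in> S \<Longrightarrow> 0 < w $ i" "\<And>i. i \<notin> S \<Longrightarrow> w $ i = 0"
    and "\<And>i. i \<in> S \<Longrightarrow> w $ i \<le> (A *v w) $ i"
    and "\<And>Z. \<lbrakk>Z \<noteq> {}; Z \<subseteq> {i\<in>S. (A *v w) $ i = w $ i}\<rbrakk> \<Longrightarrow> \<exists>i\<in>Z. \<exists>j\<in>S - Z. 0 < A $ i $ j"
  shows "\<exists>z. (\<forall>i\<in>S. 0 < z $ i \<and> z $ i < (A *v z) $ i) \<and> (\<forall>i. i \<notin> S \<longrightarrow> z $ i = 0)"
  using assms(2-)
\<comment> \<open>Induction on the number of tight indices: each round makes one of them strict and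
  creates no new ones.\<close>
proof (induction "card {i\<in>S. (A *v w) $ i = w $ i}" arbitrary: w rule: less_induct)
  case less
  define Z where "Z = {i\<in>S. (A *v w) $ i = w $ i}"
  show ?case
  proof (cases "Z = {}")
    case True
    then show ?thesis
      using less.prems(1-3) by (intro exI[of _ w]) (force simp: Z_def order_less_le)
  next
    case False
    then obtain i j where i: "i \<in> Z" and j: "j \<in> S" "j \<notin> Z" and Aij: "0 < A $ i $ j"
      using less.prems(4)[of Z] by (auto simp: Z_def)
    \<comment> \<open>Half of the slack at \<open>j\<close>: the entry there can be raised by
      \<open>d\<close> while \<open>j\<close> remains strict.\<close>
    define d where "d = ((A *v w) $ j - w $ j) / 2"
    have "w $ j < (A *v w) $ j"
      using less.prems(3)[of j] j by (auto simp: Z_def order_less_le)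
    then have d: "0 < d" "w $ j + d < (A *v w) $ j"
      by (simp_all add: d_def field_simps)
    define z where "z = w + d *\<^sub>R axis j 1"
    have z_nth: "z $ k = w $ k + (if k = j then d else 0)" for k
      by (simp add: z_def axis_def)
    have Az: "(A *v z) $ k = (A *v w) $ k + d * A $ k $ j" for k
      by (simp add: z_def matrix_vector_right_distrib matrix_vector_mult_scaleR
          matrix_vector_mult_basis column_def)
    have Az_ge: "(A *v w) $ k \<le> (A *v z) $ k" for k
      using A d by (simp add: Az nonneg_mat_def)
    have z_strict: "z $ k < (A *v z) $ k" if "k \<in> S" "k \<notin> Z - {i}" for k
    proof (cases "k = i")
      case True
      have "0 < d * A $ i $ j"
        using d Aij by simp
      then show ?thesis
        using i j True by (auto simp: z_nth Az Z_def)
    next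
      case False
      then have "w $ k < (A *v w) $ k"
        using less.prems(3)[of k] that by (auto simp: Z_def order_less_le)
      then show ?thesis
        using Az_ge[of k] d by (auto simp: z_nth)
    qed
    have z_le: "z $ k \<le> (A *v z) $ k" if "k \<in> S" for k
    proof (cases "k \<in> Z - {i}")
      case True
      then show ?thesis
        using Az_ge[of k] j less.prems(3)[OF that] by (auto simp: z_nth)
    next
      case False
      then show ?thesis
        using z_strict that by (intro less_imp_le) auto
    qed
    have tight: "{k\<in>S. (A *v z) $ k = z $ k} \<subseteq> Z - {i}"
      using z_strict by force
    have "card {k\<in>S. (A *v z) $ k = z $ k} < card Z"
      using i by (intro psubset_card_mono) (use tight in auto)
    then show ?thesis
      unfolding Z_def
    proof (rule less.hyps)
      show "0 < z $ k" if "k \<in> S" for k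
        unfolding z_nth using less.prems(1)[OF that] d by (intro add_pos_nonneg) auto
      show "z $ k = 0" if "k \<notin> S" for k
        using less.prems(2)[OF that] that j by (auto simp: z_nth)
      \<comment> \<open>The escape condition is inherited because the tight set has only
        shrunk.\<close>
      show "\<exists>i\<in>Y. \<exists>j\<in>S - Y. 0 < A $ i $ j"
        if "Y \<noteq> {}" "Y \<subseteq> {k\<in>S. (A *v z) $ k = z $ k}" for Y
        using that tight by (intro less.prems(4)) (auto simp: Z_def)
    qed (rule z_le)
  qed
qed

text \<open>Finitely many strict inequalities leave a uniform margin: the least ratio of
  \<open>A *v z\<close> to \<open>z\<close> over \<open>S\<close> exceeds one and can serve as
  \<open>t\<close> in the bound above.\<close>

lemma strictly_subinvariant_less_spec_radius:
  assumes A: "nonneg_mat A" and "S \<noteq> {}"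
    and z: "\<And>i. i \<in> S \<Longrightarrow> 0 < z $ i" "\<And>i. i \<notin> S \<Longrightarrow> z $ i = 0"
    and less: "\<And>i. i \<in> S \<Longrightarrow> z $ i < (A *v z) $ i"
  shows "1 < spec_radius A"
proof -
  define t where "t = Min ((\<lambda>i. (A *v z) $ i / z $ i) ` S)"
  have "1 < t"
    using \<open>S \<noteq> {}\<close> z less by (auto simp: t_def field_simps)
  moreover have "t \<le> spec_radius A"
  proof (rule nonneg_mat_subinvariant_le_spec_radius[OF A, of z])
    show z_nonneg: "0 \<le> z $ i" for i
      using z[of i] by (cases "i \<in> S") auto
    show "z \<noteq> 0"
      using z(1) \<open>S \<noteq> {}\<close> by fastforce
    show "t * z $ i \<le> (A *v z) $ i" for i
    proof (cases "i \<in> S")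
      case True
      then have "t \<le> (A *v z) $ i / z $ i"
        unfolding t_def by (intro Min_le) auto
      then show ?thesis
        using z(1)[OF True] by (simp add: field_simps)
    next
      case False
      have "(A *v 0) $ i \<le> (A *v z) $ i"
        using A z_nonneg by (intro nonneg_mat_mult_mono) auto
      with False show ?thesis by (simp add: z)
    qed
  qed
  ultimately show ?thesis by simp
qed

text \<open>Equality in the triangle inequality aligns all the summands.\<close>
lemma tight_row_phase:
  fixes v :: "complex^'n" and z :: complex and a :: "'n \<Rightarrow> real"
  assumes a: "\<And>j. 0 \<le> a j" and "cmod c = 1"
    and sum: "(\<Sum>j\<in>UNIV. a j * v $ j) = c * z"
    and tight: "(\<Sum>j\<in>UNIV. a j * cmod (v $ j)) = cmod z"
    and "0 < a k"
  shows "v $ k = c * sgn z * cmod (v $ k)"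
proof (cases "z = 0")
  \<comment> \<open>Here \<open>sgn z = 0\<close>, so the claim amounts to
    \<open>v $ k = 0\<close>.\<close>
  case True
  then have "a k * cmod (v $ k) = 0"
    using tight a sum_nonneg_eq_0_iff[of UNIV "\<lambda>j. a j * cmod (v $ j)"] by simp
  with \<open>0 < a k\<close> show ?thesis by simp
next
  case False
  \<comment> \<open>The common phase expected of all summands. After rotation by
    \<open>cnj e\<close>, each term falls short of its modulus by a nonnegative amount, and these
    deficits sum to zero.\<close>
  define e where "e = c * sgn z"
  have "cmod e = 1"
    using False \<open>cmod c = 1\<close> by (simp add: e_def norm_mult norm_sgn)
  then have e: "cmod e = 1" "e * cnj e = 1"
    using complex_norm_square[of e] by simp_all
  have cz: "c * z = e * cmod z"
    by (simp add: e_def sgn_eq False)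
  have Re_le: "Re (cnj e * v $ j) \<le> cmod (v $ j)" for j
    using complex_Re_le_cmod[of "cnj e * v $ j"] e by (simp add: norm_mult)
  have "(\<Sum>j\<in>UNIV. a j * Re (cnj e * v $ j)) = Re (cnj e * (\<Sum>j\<in>UNIV. a j * v $ j))"
    by (simp add: sum_distrib_left Re_sum algebra_simps)
  also have "\<dots> = (\<Sum>j\<in>UNIV. a j * cmod (v $ j))"
    using e(2) unfolding sum cz tight by (simp add: mult.assoc[symmetric] mult.commute[of "cnj e"])
  finally have "(\<Sum>j\<in>UNIV. a j * (cmod (v $ j) - Re (cnj e * v $ j))) = 0"
    by (simp add: right_diff_distrib sum_subtractf)
  then have "a k * (cmod (v $ k) - Re (cnj e * v $ k)) = 0"
    using a Re_le sum_nonneg_eq_0_iff[of UNIV "\<lambda>j. a j * (cmod (v $ j) - Re (cnj e * v $ j))"] by simp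
  then have Re: "Re (cnj e * v $ k) = cmod (cnj e * v $ k)"
    using \<open>0 < a k\<close> e by (simp add: norm_mult)
  \<comment> \<open>A complex number whose real part equals its modulus is real and
    nonnegative.\<close>
  then have "Im (cnj e * v $ k) = 0"
    using cmod_power2[of "cnj e * v $ k"] by (simp del: times_complex.sel)
  then have "cnj e * v $ k = cmod (cnj e * v $ k)"
    using Re by (intro complex_eqI) (simp_all del: times_complex.sel)
  then have "cnj e * v $ k = cmod (v $ k)"
    using e by (simp add: norm_mult)
  then have "e * (cnj e * v $ k) = e * cmod (v $ k)"
    by simp
  then show ?thesis
    using e(2) by (simp add: e_def[symmetric] mult.assoc[symmetric])
qed

lemma peripheral_eigenvalue_root_of_unity:
  fixes A :: "real^'n^'n"
  assumes A: "nonneg_mat A" and "spec_radius A \<le> 1"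
    and "eigenpair (cmat A) c v" and c: "cmod c = 1"
  shows "\<exists>q\<ge>1. c ^ q = 1"
proof -
  define S where "S = {i. v $ i \<noteq> 0}"
  define u where "u = (\<chi> i. cmod (v $ i))"
  have Av: "(\<Sum>j\<in>UNIV. A $ i $ j * v $ j) = c * v $ i" for i
    using assms(3) unfolding eigenpair_def by (metis cmat_mult_vec vector_smult_component)
  have Au: "(A *v u) $ i = (\<Sum>j\<in>UNIV. A $ i $ j * cmod (v $ j))" for i
    by (simp add: matrix_vector_mult_def u_def)
  have subinv: "u $ i \<le> (A *v u) $ i" for i
  proof -
    have "u $ i = cmod (\<Sum>j\<in>UNIV. A $ i $ j * v $ j)"
      by (simp add: Av norm_mult c u_def)
    also have "\<dots> \<le> (\<Sum>j\<in>UNIV. cmod (A $ i $ j * v $ j))"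
      by (rule norm_sum)
    also have "\<dots> = (A *v u) $ i"
      using A by (simp add: Au norm_mult nonneg_mat_def)
    finally show ?thesis .
  qed
  have "S \<noteq> {}"
    using assms(3) by (auto simp: eigenpair_def S_def vec_eq_iff)
  have "\<exists>Z. Z \<noteq> {} \<and> Z \<subseteq> {i\<in>S. (A *v u) $ i = u $ i} \<and> \<not> (\<exists>i\<in>Z. \<exists>j\<in>S - Z. 0 < A $ i $ j)"
  proof (rule ccontr)
    assume "\<not> ?thesis"
    then have "\<exists>z. (\<forall>i\<in>S. 0 < z $ i \<and> z $ i < (A *v z) $ i) \<and> (\<forall>i. i \<notin> S \<longrightarrow> z $ i = 0)"
      by (intro strictly_subinvariant_vector[OF A, of S u] subinv) (auto simp: S_def u_def)
    then obtain z where "\<forall>i\<in>S. 0 < z $ i \<and> z $ i < (A *v z) $ i" "\<forall>i. i \<notin> S \<longrightarrow> z $ i = 0"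
      by blast
    then have "1 < spec_radius A"
      by (intro strictly_subinvariant_less_spec_radius[OF A \<open>S \<noteq> {}\<close>, of z]) auto
    with \<open>spec_radius A \<le> 1\<close> show False by simp
  qed
  then obtain Z where "Z \<noteq> {}" and tight: "\<And>i. i \<in> Z \<Longrightarrow> v $ i \<noteq> 0 \<and> (A *v u) $ i = u $ i"
    and closed: "\<And>i j. \<lbrakk>i \<in> Z; v $ j \<noteq> 0; 0 < A $ i $ j\<rbrakk> \<Longrightarrow> j \<in> Z"
    by (auto simp: S_def)
  have "\<exists>j. j \<in> Z \<and> sgn (v $ j) = c * sgn (v $ i)" if i: "i \<in> Z" for i
  proof -
    have eq: "(\<Sum>j\<in>UNIV. A $ i $ j * cmod (v $ j)) = cmod (v $ i)"
      using tight[OF i] by (simp add: Au) (simp add: u_def)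
    then have "(\<Sum>j\<in>UNIV. A $ i $ j * cmod (v $ j)) \<noteq> 0"
      using tight[OF i] by simp
    then obtain j where "A $ i $ j * cmod (v $ j) \<noteq> 0"
      by (metis (no_types, lifting) sum.neutral)
    then have j: "v $ j \<noteq> 0" "0 < A $ i $ j"
      using A by (auto simp: nonneg_mat_def order_less_le)
    have "v $ j = c * sgn (v $ i) * cmod (v $ j)"
      using A by (intro tight_row_phase[OF _ c Av eq]) (auto simp: nonneg_mat_def j)
    then have "sgn (v $ j) = c * sgn (v $ i)"
      using j by (simp add: sgn_eq field_simps)
    with closed[OF i j] show ?thesis by blast
  qed
  \<comment> \<open>\<open>f\<close> picks a successor along an edge inside \<open>Z\<close>; each
    application multiplies the phase by \<open>c\<close>.\<close>
  then obtain f where f: "\<And>i. i \<in> Z \<Longrightarrow> f i \<in> Z \<and> sgn (v $ f i) = c * sgn (v $ i)"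
    by metis
  obtain i where i: "i \<in> Z"
    using \<open>Z \<noteq> {}\<close> by blast
  have orbit: "(f ^^ k) i \<in> Z \<and> sgn (v $ (f ^^ k) i) = c ^ k * sgn (v $ i)" for k
    using i f by (induction k) auto
  \<comment> \<open>The index type is finite, so the orbit of \<open>i\<close> revisits some index,
    and comparing the two phases there gives \<open>c ^ k = c ^ l\<close>.\<close>
  have "\<not> inj (\<lambda>k. (f ^^ k) i)"
    using finite_imageD[of "\<lambda>k. (f ^^ k) i" UNIV] by (auto simp: finite_subset[OF subset_UNIV])
  then obtain k l where kl: "k < l" "(f ^^ k) i = (f ^^ l) i"
    by (metis injI linorder_neqE_nat)
  then have "c ^ k * sgn (v $ i) = c ^ l * sgn (v $ i)"
    using orbit kl(2) by metis
  then have "c ^ k = c ^ l"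
    using tight[OF i] by (simp add: sgn_zero_iff)
  moreover have "c ^ l = c ^ k * c ^ (l - k)"
    using kl(1) by (simp flip: power_add)
  moreover have "c \<noteq> 0"
    using c by auto
  ultimately show ?thesis
    using kl(1) by (intro exI[of _ "l - k"]) auto
qed

section \<open>Eigenvalues along a word\<close>

lemma root_of_unity_imp_cmod_1:
  fixes a :: complex
  assumes "1 \<le> q" "a ^ q = 1"
  shows "cmod a = 1"
  using power_eq_1_iff[OF assms(2)] assms(1) by auto

text \<open>One contracting factor suffices, as the other has modulus at most one; otherwise both
  are roots of unity and the product of their exponents works.\<close>

lemma contracting_or_root_of_unity_mult:
  fixes a b :: complex
  assumes a: "cmod a < 1 \<or> (\<exists>q\<ge>1. a ^ q = 1)"
    and b: "cmod b < 1 \<or> (\<exists>q\<ge>1. b ^ q = 1)"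
  shows "cmod (a * b) < 1 \<or> (\<exists>q\<ge>1. (a * b) ^ q = 1)"
proof (cases "cmod a < 1 \<or> cmod b < 1")
  case True
  moreover have "cmod a \<le> 1" "cmod b \<le> 1"
    using a b root_of_unity_imp_cmod_1 by (auto simp: less_imp_le)
  ultimately have "cmod a * cmod b < 1"
    using mult_left_le[of "cmod b" "cmod a"] mult_left_le_one_le[of "cmod b" "cmod a"] by force
  then show ?thesis
    by (simp add: norm_mult)
next
  case False
  then obtain q r where "1 \<le> q" "a ^ q = 1" "1 \<le> r" "b ^ r = 1"
    using a b by auto
  moreover from this have "(a * b) ^ (q * r) = 1"
    using power_mult[of a q r] power_mult[of b r q] by (simp add: power_mult_distrib mult.commute)
  moreover have "1 \<le> q * r"
    using \<open>1 \<le> q\<close> \<open>1 \<le> r\<close> by simp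
  ultimately show ?thesis by blast
qed

text \<open>Each letter scales \<open>v\<close> by a number of modulus at most one, which is a root
  of unity when the modulus equals one; these factors multiply along the word.\<close>

lemma word_mat_eigenvalue:
  assumes "\<And>r. r \<in> {1..N} \<Longrightarrow> nonneg_mat (A r)"
    and "\<And>r. r \<in> {1..N} \<Longrightarrow> spec_radius (A r) \<le> 1"
    and "v \<in> common_eigvecs A N" and "set \<omega> \<subseteq> {1..N}"
  shows "\<exists>\<mu>. cmat (word_mat A \<omega>) *v v = \<mu> *s v \<and> (cmod \<mu> < 1 \<or> (\<exists>q\<ge>1. \<mu> ^ q = 1))"
  using assms(4)
proof (induction \<omega>)
  case Nil
  show ?case by (auto simp: cmat_one intro!: exI[of _ 1])
next
  case (Cons r \<omega>)
  then obtain \<mu> where \<mu>: "cmat (word_mat A \<omega>) *v v = \<mu> *s v"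
      "cmod \<mu> < 1 \<or> (\<exists>q\<ge>1. \<mu> ^ q = 1)"
    by auto
  have r: "r \<in> {1..N}"
    using Cons.prems by simp
  then obtain c where c: "eigenpair (cmat (A r)) c v"
    using assms(3) unfolding common_eigvecs_def eigvec_def by blast
  have "cmod c \<le> 1"
    using eigenpair_cmod_le_spec_radius[OF c] assms(2)[OF r] by simp
  then have "cmod c < 1 \<or> (\<exists>q\<ge>1. c ^ q = 1)"
    using peripheral_eigenvalue_root_of_unity[OF assms(1,2)[OF r] c] by (auto simp: order_le_less)
  then have "cmod (c * \<mu>) < 1 \<or> (\<exists>q\<ge>1. (c * \<mu>) ^ q = 1)"
    using \<mu>(2) by (rule contracting_or_root_of_unity_mult)
  moreover have "cmat (word_mat A (r # \<omega>)) *v v = (c * \<mu>) *s v"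
    using c \<mu>(1)
    by (simp add: cmat_mult eigenpair_def vector_scalar_commute flip: matrix_vector_mul_assoc)
  ultimately show ?case by blast
qed

section \<open>Iterates of the matrix and of the conjugated map\<close>

lemma convergent_power_of_root_of_unity_power:
  fixes a :: complex
  assumes "cmod a < 1 \<or> a ^ q = 1" "1 \<le> q"
  shows "convergent (\<lambda>k. a ^ (k * q))"
proof (cases "a ^ q = 1")
  case True
  then show ?thesis
    by (simp add: mult.commute[of _ q] power_mult convergent_const)
next
  case False
  then have "cmod (a ^ q) < 1"
    using assms by (simp add: norm_power power_less_one_iff)
  then show ?thesis
    using LIMSEQ_power_zero unfolding mult.commute[of _ q] power_mult convergent_def by blast
qed

text \<open>Stated after complexification because the individual summands need not be real.\<close>

lemma cvec_funpow_eigen_combination: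
  assumes "cvec x = (\<Sum>v\<in>E. \<alpha> v *s v)" and "\<And>v. v \<in> E \<Longrightarrow> cmat M *v v = \<mu> v *s v"
  shows "cvec ((((*v) M) ^^ k) x) = (\<Sum>v\<in>E. (\<alpha> v * \<mu> v ^ k) *s v)"
proof (induction k)
  case 0
  show ?case by (simp add: assms(1))
next
  case (Suc k)
  have "cvec ((((*v) M) ^^ Suc k) x) = cmat M *v (\<Sum>v\<in>E. (\<alpha> v * \<mu> v ^ k) *s v)"
    by (simp add: Suc.IH[symmetric] cmat_mult_cvec)
  also have "\<dots> = (\<Sum>v\<in>E. (\<alpha> v * \<mu> v ^ Suc k) *s v)"
    by (simp add: vec.linear_sum[OF matrix_vector_mul_linear_gen] vector_scalar_commute assms(2)
        mult_ac cong: sum.cong)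
  finally show ?case .
qed

text \<open>\<open>vlog\<close> undoes \<open>vexp\<close>, so in logarithmic coordinates the
  iteration is linear.\<close>

lemma funpow_word_map_vexp:
  "(word_map A \<omega> ^^ k) (vexp x) = vexp ((((*v) (word_mat A \<omega>)) ^^ k) x)"
  by (induction k) (simp_all add: word_map_def vlog_def vexp_def)

lemma vexp_in_pos_orthant: "vexp x \<in> pos_orthant"
  by (simp add: vexp_def pos_orthant_def)

lemma tendsto_vexp:
  assumes "(f \<longlongrightarrow> x) F"
  shows "((\<lambda>k. vexp (f k)) \<longlongrightarrow> vexp x) F"
  unfolding vexp_def using assms by (intro tendsto_intros)

lemma tendsto_funpow_matrix_mult:
  fixes M :: "real^'n^'n"
  assumes "(f \<longlongrightarrow> x) F"
  shows "((\<lambda>k. (((*v) M) ^^ q) (f k)) \<longlongrightarrow> (((*v) M) ^^ q) x) F"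
  using assms
  by (induction q) (auto intro: bounded_linear.tendsto[OF matrix_vector_mul_bounded_linear])

theorem theorem2p2:
  fixes A :: "nat \<Rightarrow> real^'n^'n"
    and N p :: nat
    and E :: "(complex^'n) set"
    and \<omega> :: "nat list"
    and x y :: "real^'n"
  assumes "\<And>r. r \<in> {1..N} \<Longrightarrow> nonneg_mat (A r)"
    and "\<And>r. r \<in> {1..N} \<Longrightarrow> spec_radius (A r) = 1"
    and "N = 2 \<Longrightarrow> partially_commuting (A 1) (A 2) \<or> quasi_commuting A N \<or> laffey_pair (A 1) (A 2)"
    and "N \<ge> 3 \<Longrightarrow> quasi_commuting A N"
    and "common_eigvec_list A N E"
    and "p \<ge> 1" and "\<omega> \<in> words N p"
    and "x \<in> LC E" and "y = vexp x"
  shows "\<exists>q\<ge>1. \<exists>\<eta>\<in>pos_orthant.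
           (\<lambda>k. (word_map A \<omega> ^^ (k * q)) y) \<longlonglongrightarrow> \<eta> \<and>
           periodic_point (word_map A \<omega>) \<eta> \<and>
           least_power (word_map A \<omega>) \<eta> dvd q"
proof -
  define M where "M = word_mat A \<omega>"
  have "finite E" and E: "E \<subseteq> common_eigvecs A N"
    using assms(5) by (auto simp: common_eigvec_list_def vec.finiteI_independent)
  obtain \<alpha> where x: "cvec x = (\<Sum>v\<in>E. \<alpha> v *s v)"
    using assms(8) by (auto simp: LC_def)
  have "\<exists>\<mu>. cmat M *v v = \<mu> *s v \<and> (cmod \<mu> < 1 \<or> (\<exists>q\<ge>1. \<mu> ^ q = 1))" if "v \<in> E" for v
    unfolding M_def
    by (rule word_mat_eigenvalue[where N = N]) (use assms(1,2,7) E that in \<open>auto simp: words_def\<close>)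
  then obtain \<mu> where \<mu>: "\<And>v. v \<in> E \<Longrightarrow> cmat M *v v = \<mu> v *s v"
    and "\<And>v. v \<in> E \<Longrightarrow> cmod (\<mu> v) < 1 \<or> (\<exists>q\<ge>1. \<mu> v ^ q = 1)"
    by metis
  \<comment> \<open>For a contracting factor any positive exponent will do, for instance 1.\<close>
  then have "\<forall>v\<in>E. \<exists>q\<ge>1. cmod (\<mu> v) < 1 \<or> \<mu> v ^ q = 1"
    by (metis order_refl)
  then obtain ord where ord: "\<And>v. v \<in> E \<Longrightarrow> 1 \<le> ord v \<and> (cmod (\<mu> v) < 1 \<or> \<mu> v ^ ord v = (1::complex))"
    by metis
  define q where "q = (\<Prod>v\<in>E. ord v)"
  have "1 \<le> q"
    unfolding q_def using ord by (intro prod_ge_1) blast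
  have "cmod (\<mu> v) < 1 \<or> \<mu> v ^ q = 1" if v: "v \<in> E" for v
  proof -
    have "ord v dvd q"
      unfolding q_def using \<open>finite E\<close> v by (rule dvd_prodI)
    then obtain m where "q = ord v * m" ..
    then show ?thesis
      using ord[OF v] by (auto simp: power_mult)
  qed
  then have "\<forall>v\<in>E. \<exists>l. (\<lambda>k. \<mu> v ^ (k * q)) \<longlonglongrightarrow> l"
    using convergent_power_of_root_of_unity_power \<open>1 \<le> q\<close> by (metis convergentD)
  then obtain l where l: "\<And>v. v \<in> E \<Longrightarrow> (\<lambda>k. \<mu> v ^ (k * q)) \<longlonglongrightarrow> l v"
    by metis
  define h where "h k = (((*v) M) ^^ (k * q)) x" for k
  \<comment> \<open>The termwise limit of the eigenvector expansion; \<open>Re\<close> brings it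
    back to real vectors and commutes with the limit.\<close>
  define \<xi> where "\<xi> = (\<chi> i. Re (\<Sum>v\<in>E. \<alpha> v * l v * v $ i))"
  have h: "h \<longlonglongrightarrow> \<xi>"
  proof (rule vec_tendstoI)
    fix i
    have "h k $ i = Re (\<Sum>v\<in>E. \<alpha> v * \<mu> v ^ (k * q) * v $ i)" for k
    proof -
      have "h k $ i = Re (cvec (h k) $ i)"
        by (simp add: cvec_def)
      then show ?thesis
        unfolding h_def by (subst (asm) cvec_funpow_eigen_combination[OF x \<mu>]) (auto simp: sum_component)
    qed
    then show "(\<lambda>k. h k $ i) \<longlonglongrightarrow> \<xi> $ i"
      unfolding \<xi>_def by (simp only: vec_lambda_beta) (intro tendsto_intros l)
  qed
  \<comment> \<open>Applying the \<open>q\<close>-th power of the linear map shifts \<open>h\<close>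
    by one step, so by continuity it fixes the limit.\<close>
  have "(((*v) M) ^^ q) \<xi> = \<xi>"
  proof (rule LIMSEQ_unique)
    have "(((*v) M) ^^ q) (h k) = h (Suc k)" for k
      by (simp add: h_def funpow_add)
    then show "(\<lambda>k. h (Suc k)) \<longlonglongrightarrow> (((*v) M) ^^ q) \<xi>"
      using tendsto_funpow_matrix_mult[OF h, of q M] by simp
    show "(\<lambda>k. h (Suc k)) \<longlonglongrightarrow> \<xi>"
      using h by (rule LIMSEQ_Suc)
  qed
  then have per: "(word_map A \<omega> ^^ q) (vexp \<xi>) = vexp \<xi>"
    by (simp add: funpow_word_map_vexp M_def)
  have "(\<lambda>k. (word_map A \<omega> ^^ (k * q)) y) \<longlonglongrightarrow> vexp \<xi>"
    using tendsto_vexp[OF h] by (simp add: assms(9) funpow_word_map_vexp h_def M_def)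
  moreover have "periodic_point (word_map A \<omega>) (vexp \<xi>)"
    using per \<open>1 \<le> q\<close> by (auto simp: periodic_point_def)
  moreover have "least_power (word_map A \<omega>) (vexp \<xi>) dvd q"
    using per by (rule least_power_minimal)
  ultimately show ?thesis
    using \<open>1 \<le> q\<close> vexp_in_pos_orthant by blast
qed

end
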